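(* If $\lim_{n\to\infty}|\mathcal{S}_{n-1}|/|\mathcal{S}_n|=0$, then $\lim_{n\to\infty}|\mathcal{B}_n|/|\mathcal{S}_n|=1$.
   Context: $\mathcal{S}_n$ is the set of unlabeled (up to isomorphism) split graphs on $n$ vertices, where a split graph is a finite simple graph whose vertex set partitions as $K\cup S$ with $K$ a clique and $S$ a stable set. A split graph $G$ is balanced if it has such a partition with $|K|=\omega(G)$ (clique number) and $|S|=\alpha(G)$ (independence number); $\mathcal{B}_n$ is the set of unlabeled balanced split graphs on $n$ vertices. *)

theory Defs
  imports Complex_Main
begin

text \<open>A finite simple graph is given by its vertex set \<open>V\<close> and its set \<open>E\<close> of two-element edges.\<close>

definition simple_graph :: "'a set \<Rightarrow> 'a set set \<Rightarrow> bool" where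
  "simple_graph V E \<longleftrightarrow> finite V \<and> (\<forall>e\<in>E. e \<subseteq> V \<and> card e = 2)"

definition clique :: "'a set \<Rightarrow> 'a set set \<Rightarrow> 'a set \<Rightarrow> bool" where
  "clique V E K \<longleftrightarrow> K \<subseteq> V \<and> (\<forall>u\<in>K. \<forall>v\<in>K. u \<noteq> v \<longrightarrow> {u, v} \<in> E)"

definition stable_set :: "'a set \<Rightarrow> 'a set set \<Rightarrow> 'a set \<Rightarrow> bool" where
  "stable_set V E S \<longleftrightarrow> S \<subseteq> V \<and> (\<forall>u\<in>S. \<forall>v\<in>S. {u, v} \<notin> E)"

definition clique_number :: "'a set \<Rightarrow> 'a set set \<Rightarrow> nat" where
  "clique_number V E = Max {card K | K. clique V E K}"

definition independence_number :: "'a set \<Rightarrow> 'a set set \<Rightarrow> nat" where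
  "independence_number V E = Max {card S | S. stable_set V E S}"

text \<open>Either part of a partition may be empty.\<close>

definition split_partition :: "'a set \<Rightarrow> 'a set set \<Rightarrow> 'a set \<Rightarrow> 'a set \<Rightarrow> bool" where
  "split_partition V E K S \<longleftrightarrow>
     K \<union> S = V \<and> K \<inter> S = {} \<and> clique V E K \<and> stable_set V E S"

definition split_graph :: "'a set \<Rightarrow> 'a set set \<Rightarrow> bool" where
  "split_graph V E \<longleftrightarrow> simple_graph V E \<and> (\<exists>K S. split_partition V E K S)"

definition balanced_split_graph :: "'a set \<Rightarrow> 'a set set \<Rightarrow> bool" where
  "balanced_split_graph V E \<longleftrightarrow> simple_graph V E \<and>
     (\<exists>K S. split_partition V E K S \<and>
        card K = clique_number V E \<and> card S = independence_number V E)"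

definition graph_iso :: "'a set \<Rightarrow> 'a set set \<Rightarrow> 'b set \<Rightarrow> 'b set set \<Rightarrow> bool" where
  "graph_iso V E V' E' \<longleftrightarrow>
     (\<exists>f. bij_betw f V V' \<and> (\<forall>u\<in>V. \<forall>v\<in>V. {u, v} \<in> E \<longleftrightarrow> {f u, f v} \<in> E'))"

text \<open>
  Every graph on \<open>n\<close> vertices is isomorphic to one with vertex set \<open>{..<n}\<close>, so unlabeled graphs
  on \<open>n\<close> vertices are the classes of the following relation on edge sets over \<open>{..<n}\<close>.
\<close>

definition iso_rel :: "nat \<Rightarrow> (nat set set \<times> nat set set) set" where
  "iso_rel n = {(E, E'). simple_graph {..<n} E \<and> simple_graph {..<n} E' \<and>
                         graph_iso {..<n} E {..<n} E'}"

definition unlabeled_split_graphs :: "nat \<Rightarrow> nat set set set set" where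
  "unlabeled_split_graphs n = {E. split_graph {..<n} E} // iso_rel n"

definition unlabeled_balanced_split_graphs :: "nat \<Rightarrow> nat set set set set" where
  "unlabeled_balanced_split_graphs n = {E. balanced_split_graph {..<n} E} // iso_rel n"

lemma equiv_iso_rel: "equiv {E. simple_graph {..<n} E} (iso_rel n)"
proof (rule equivI)
  show "iso_rel n \<subseteq> {E. simple_graph {..<n} E} \<times> {E. simple_graph {..<n} E}"
    by (auto simp: iso_rel_def)
  show "refl_on {E. simple_graph {..<n} E} (iso_rel n)"
    by (auto simp: refl_on_def iso_rel_def graph_iso_def intro!: exI[of _ id])
  show "sym (iso_rel n)"
  proof (rule symI)
    fix E E' assume "(E, E') \<in> iso_rel n"
    then obtain f where s: "simple_graph {..<n} E" "simple_graph {..<n} E'"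
      and f: "bij_betw f {..<n} {..<n}"
      and e: "\<forall>u\<in>{..<n}. \<forall>v\<in>{..<n}. {u, v} \<in> E \<longleftrightarrow> {f u, f v} \<in> E'"
      by (auto simp: iso_rel_def graph_iso_def)
    let ?g = "inv_into {..<n} f"
    have g: "bij_betw ?g {..<n} {..<n}" using f by (rule bij_betw_inv_into)
    have "{u, v} \<in> E' \<longleftrightarrow> {?g u, ?g v} \<in> E" if "u \<in> {..<n}" "v \<in> {..<n}" for u v
      using e that bij_betwE[OF g] bij_betw_inv_into_right[OF f] by metis
    then show "(E', E) \<in> iso_rel n"
      using s g unfolding iso_rel_def graph_iso_def by blast
  qed
  show "trans (iso_rel n)"
  proof (rule transI)
    fix E E' E'' assume a: "(E, E') \<in> iso_rel n" and b: "(E', E'') \<in> iso_rel n"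
    from a obtain f where f: "simple_graph {..<n} E" "bij_betw f {..<n} {..<n}"
      "\<forall>u\<in>{..<n}. \<forall>v\<in>{..<n}. {u, v} \<in> E \<longleftrightarrow> {f u, f v} \<in> E'"
      by (auto simp: iso_rel_def graph_iso_def)
    from b obtain g where g: "simple_graph {..<n} E''" "bij_betw g {..<n} {..<n}"
      "\<forall>u\<in>{..<n}. \<forall>v\<in>{..<n}. {u, v} \<in> E' \<longleftrightarrow> {g u, g v} \<in> E''"
      by (auto simp: iso_rel_def graph_iso_def)
    have "bij_betw (g \<circ> f) {..<n} {..<n}" using f(2) g(2) by (rule bij_betw_trans)
    moreover have "\<forall>u\<in>{..<n}. \<forall>v\<in>{..<n}. {u, v} \<in> E \<longleftrightarrow> {(g \<circ> f) u, (g \<circ> f) v} \<in> E''"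
      using f(3) g(3) bij_betwE[OF f(2)] by simp
    ultimately show "(E, E'') \<in> iso_rel n"
      using f(1) g(1) unfolding iso_rel_def graph_iso_def by blast
  qed
qed

end

theory Submission
  imports Defs "HOL-Combinatorics.Transposition"
begin

text \<open>
  An unbalanced split graph on \<open>n\<close> vertices has a split partition \<open>(K, S)\<close> and a swing vertex
  \<open>v \<in> K\<close> for which \<open>S \<union> {v}\<close> is stable. The graph is recovered from \<open>G - v\<close> and the clique
  \<open>K - {v}\<close> by joining a new vertex to that clique. Any two split partitions of a graph have cliques
  whose sizes differ by at most one, and if the sizes agree, an automorphism maps one clique onto
  the other. So each unlabeled split graph on \<open>n - 1\<close> vertices arises from at most two unlabeled
  unbalanced ones, told apart by the parity of the clique, and
  \<open>\<bar>\<S>\<^sub>n\<bar> - \<bar>\<B>\<^sub>n\<bar> \<le> 2 \<bar>\<S>\<^bsub>n-1\<^esub>\<bar>\<close>.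
\<close>

section \<open>Isomorphisms with an explicit vertex map, and transport of split partitions\<close>

definition isomorphism :: "('a \<Rightarrow> 'b) \<Rightarrow> 'a set \<Rightarrow> 'a set set \<Rightarrow> 'b set \<Rightarrow> 'b set set \<Rightarrow> bool" where
  "isomorphism f V E V' E' \<longleftrightarrow>
     bij_betw f V V' \<and> (\<forall>u\<in>V. \<forall>v\<in>V. {u, v} \<in> E \<longleftrightarrow> {f u, f v} \<in> E')"

lemma graph_iso_iff: "graph_iso V E V' E' \<longleftrightarrow> (\<exists>f. isomorphism f V E V' E')"
  by (simp add: graph_iso_def isomorphism_def)

lemma isomorphism_comp:
  assumes "isomorphism f V E V' E'" "isomorphism g V' E' V'' E''"
  shows "isomorphism (g \<circ> f) V E V'' E''"
  using assms bij_betw_trans[of f V V' g V''] bij_betwE[of f V V']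
  by (simp add: isomorphism_def)

lemma isomorphism_image_edges:
  assumes f: "bij_betw f V V'" and E: "simple_graph V E"
  shows "isomorphism f V E V' ((`) f ` E)" "simple_graph V' ((`) f ` E)"
proof -
  have inj: "inj_on f V" and im: "f ` V = V'"
    using f by (auto simp: bij_betw_def)
  have sub: "e \<subseteq> V" "card e = 2" if "e \<in> E" for e
    using E that by (auto simp: simple_graph_def)
  have "{f u, f v} \<in> (`) f ` E \<longleftrightarrow> {u, v} \<in> E" if "u \<in> V" "v \<in> V" for u v
  proof
    assume "{f u, f v} \<in> (`) f ` E"
    then obtain e where e: "e \<in> E" "f ` {u, v} = f ` e"
      by auto
    then have "{u, v} = e"
      using inj_on_image_eq_iff[OF inj, of "{u, v}" e] that sub(1)[OF e(1)] by simp
    with e show "{u, v} \<in> E"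
      by simp
  next
    assume "{u, v} \<in> E"
    then have "f ` {u, v} \<in> (`) f ` E"
      by (rule imageI)
    then show "{f u, f v} \<in> (`) f ` E"
      by simp
  qed
  then show "isomorphism f V E V' ((`) f ` E)"
    using f by (simp add: isomorphism_def)
  have "card (f ` e) = 2" if "e \<in> E" for e
    using sub[OF that] card_image[OF inj_on_subset[OF inj]] by simp
  then show "simple_graph V' ((`) f ` E)"
    using E sub(1) im by (fastforce simp: simple_graph_def)
qed

lemma clique_image:
  assumes "isomorphism f V E V' E'" "clique V E K"
  shows "clique V' E' (f ` K)"
  using assms unfolding isomorphism_def clique_def bij_betw_def by (auto simp: subset_iff) metis

lemma stable_set_image:
  assumes "isomorphism f V E V' E'" "stable_set V E S"
  shows "stable_set V' E' (f ` S)"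
  using assms unfolding isomorphism_def stable_set_def bij_betw_def by (auto simp: subset_iff)

lemma split_partition_image:
  assumes f: "isomorphism f V E V' E'" and KS: "split_partition V E K S"
  shows "split_partition V' E' (f ` K) (f ` S)"
proof -
  have bij: "inj_on f V" "f ` V = V'"
    using f by (auto simp: isomorphism_def bij_betw_def)
  have "f ` K \<inter> f ` S = f ` (K \<inter> S)"
    using inj_on_image_Int[OF bij(1), of K S] KS by (auto simp: split_partition_def)
  then show ?thesis
    using KS bij clique_image[OF f] stable_set_image[OF f] by (auto simp: split_partition_def)
qed

section \<open>Two split partitions of the same graph\<close>

lemma card_clique_Int_stable_le:
  assumes "clique V E K" "stable_set V E S" "finite V"
  shows "card (K \<inter> S) \<le> 1"
proof -
  have "finite (K \<inter> S)"
    using assms by (meson clique_def finite_Int finite_subset)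
  moreover have "u = v" if "u \<in> K \<inter> S" "v \<in> K \<inter> S" for u v
    using assms that unfolding clique_def stable_set_def by blast
  ultimately show ?thesis
    by (simp add: card_le_Suc0_iff_eq)
qed

text \<open>\<open>K\<close> lies in \<open>K' \<union> (K \<inter> S')\<close>, and a clique meets
  a stable set in at most one vertex.\<close>

lemma card_split_clique_le:
  assumes "split_partition V E K S" "split_partition V E K' S'" "finite V"
  shows "card K \<le> card K' + 1"
proof -
  have "K \<subseteq> K' \<union> (K \<inter> S')" and fin: "finite K'" "finite (K \<inter> S')"
    using assms finite_subset[of _ V] by (auto simp: split_partition_def)
  then have "card K \<le> card (K' \<union> (K \<inter> S'))"
    by (intro card_mono) auto
  also have "\<dots> \<le> card K' + card (K \<inter> S')"
    by (rule card_Un_le)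
  also have "card (K \<inter> S') \<le> 1"
    using assms card_clique_Int_stable_le by (auto simp: split_partition_def)
  finally show ?thesis
    by simp
qed

text \<open>Distinct split cliques of equal size differ by exchanging one vertex \<open>a\<close>
  for one vertex \<open>b\<close>. Apart from each other these two have the same neighbours, so
  transposing them is an automorphism.\<close>

lemma split_partition_automorphism:
  assumes KS: "split_partition V E K S" and KS': "split_partition V E K' S'"
    and fin: "finite V" and card: "card K = card K'"
  shows "\<exists>g. isomorphism g V E V E \<and> g ` K = K'"
proof (cases "K = K'")
  case True
  then show ?thesis
    by (intro exI[of _ id]) (auto simp: isomorphism_def)
next
  case False
  have V: "K \<union> S = V" "K \<inter> S = {}" "K' \<union> S' = V" "K' \<inter> S' = {}"
    and cl: "clique V E K" "clique V E K'" and st: "stable_set V E S" "stable_set V E S'"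
    using KS KS' by (auto simp: split_partition_def)
  have finK: "finite K" "finite K'"
    using V fin by (metis finite_Un)+
  have "\<not> K \<subseteq> K'" "\<not> K' \<subseteq> K"
    using False card card_subset_eq finK by metis+
  then obtain a b where a: "a \<in> K" "a \<notin> K'" and b: "b \<in> K'" "b \<notin> K"
    by blast
  have aS: "a \<in> S'" and bS: "b \<in> S"
    using a b V by auto
  \<comment> \<open>Distinct vertices of \<open>K \<inter> S'\<close> would be adjacent by the
    clique \<open>K\<close> and non-adjacent by the stable set \<open>S'\<close>.\<close>
  have "x = a" if "x \<in> K \<inter> S'" for x
    using that a aS cl(1) st(2) unfolding clique_def stable_set_def by blast
  then have Ka: "K \<inter> S' = {a}"
    using a aS by blast
  have "x = b" if "x \<in> K' \<inter> S" for x
    using that b bS cl(2) st(1) unfolding clique_def stable_set_def by blast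
  then have Kb: "K' \<inter> S = {b}"
    using b bS by blast
  let ?g = "transpose a b"
  \<comment> \<open>\<open>stable_set\<close> also covers \<open>u = v\<close>, where
    \<open>{u, v}\<close> is a singleton.\<close>
  have loop: "{a} \<notin> E" "{b} \<notin> E"
    using aS bS st unfolding stable_set_def by fastforce+
  \<comment> \<open>Only \<open>a\<close> and \<open>b\<close> change sides: any other
    \<open>w\<close> lies in \<open>K \<inter> K'\<close> and is adjacent to both, or in
    \<open>S \<inter> S'\<close> and is adjacent to neither.\<close>
  have nb: "{a, w} \<in> E \<longleftrightarrow> {b, w} \<in> E" if "w \<in> V" "w \<noteq> a" "w \<noteq> b" for w
  proof (cases "w \<in> K")
    case True
    then have "w \<in> K'"
      using Ka that V by blast
    then show ?thesis
      using True that a b cl unfolding clique_def by metis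
  next
    case False
    then have "w \<in> S" "w \<in> S'"
      using Kb that V by blast+
    then show ?thesis
      using aS bS st unfolding stable_set_def by blast
  qed
  have one: "{a, v} \<in> E \<longleftrightarrow> {b, ?g v} \<in> E" "{b, v} \<in> E \<longleftrightarrow> {a, ?g v} \<in> E" if "v \<in> V" for v
    using that nb[of v] loop
    by (cases "v = a"; cases "v = b"; simp add: insert_commute[of a b])+
  have "{u, v} \<in> E \<longleftrightarrow> {?g u, ?g v} \<in> E" if "u \<in> V" "v \<in> V" for u v
  proof -
    consider "u = a" | "u = b" | "v = a" | "v = b" | "?g u = u" "?g v = v"
      by (metis transpose_apply_other)
    then show ?thesis
      using that one[of u] one[of v]
      by cases (simp_all add: insert_commute[of u] insert_commute[of "?g u"])
  qed
  moreover have "bij_betw ?g V V"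
    using a b V by (intro bij_betw_byWitness[where f' = ?g]) (auto simp: transpose_def)
  moreover have "?g ` K = K'"
  proof -
    have "K \<inter> S' = K - K'" "K' \<inter> S = K' - K"
      using V by blast+
    then have "K = insert a (K \<inter> K')" "K' = insert b (K \<inter> K')"
      using Ka Kb by blast+
    moreover have "?g ` (K \<inter> K') = K \<inter> K'"
      using a b by (force simp: transpose_def image_iff)
    ultimately show ?thesis
      by (metis image_insert transpose_apply_first)
  qed
  ultimately show ?thesis
    unfolding isomorphism_def by blast
qed

section \<open>Joining a new vertex to a set of vertices, and deleting it again\<close>

definition add_vertex :: "'a \<Rightarrow> 'a set \<Rightarrow> 'a set set \<Rightarrow> 'a set set" where
  "add_vertex x K E = E \<union> (\<lambda>u. {x, u}) ` K"

lemma add_vertex_old: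
  assumes "u \<noteq> x" "v \<noteq> x"
  shows "{u, v} \<in> add_vertex x K E \<longleftrightarrow> {u, v} \<in> E"
  using assms by (auto simp: add_vertex_def doubleton_eq_iff)

lemma add_vertex_new:
  assumes "{x, v} \<notin> E"
  shows "{x, v} \<in> add_vertex x K E \<longleftrightarrow> v \<in> K"
  using assms by (auto simp: add_vertex_def doubleton_eq_iff)

text \<open>For comparing extensions: it is enough that an isomorphism of the smaller graphs carries
  one attachment set onto the other, since the new vertices are fresh and can be matched with each
  other.\<close>

lemma isomorphism_add_vertex:
  assumes f: "isomorphism f V E V' E'" and K: "K \<subseteq> V"
    and E: "simple_graph V E" "simple_graph V' E'" and x: "x \<notin> V" "y \<notin> V'"
  shows "isomorphism (f(x := y)) (insert x V) (add_vertex x K E)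
           (insert y V') (add_vertex y (f ` K) E')"
proof -
  let ?f = "f(x := y)"
  have bij: "inj_on f V" "f ` V = V'"
    using f by (auto simp: isomorphism_def bij_betw_def)
  have "f u \<in> V'" if "u \<in> V" for u
    using bij that by auto
  then have fy: "f u \<noteq> y" if "u \<in> V" for u
    using that x by auto
  have nE: "{x, u} \<notin> E" "{y, w} \<notin> E'" for u w
    using E x by (auto simp: simple_graph_def)
  have fK: "f u \<in> f ` K \<longleftrightarrow> u \<in> K" if "u \<in> V" for u
    using inj_on_image_mem_iff[OF bij(1) that K] .
  have xK: "x \<notin> K" "y \<notin> f ` K"
    using x K bij by auto
  have adj: "{u, v} \<in> E \<longleftrightarrow> {f u, f v} \<in> E'" if "u \<in> V" "v \<in> V" for u v
    using f that by (auto simp: isomorphism_def)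
  \<comment> \<open>For old \<open>v\<close> both sides say that \<open>v\<close> belongs to the
    attachment set, which injectivity of \<open>f\<close> preserves. For \<open>v = x\<close> both
    sides are false.\<close>
  have one: "{x, v} \<in> add_vertex x K E \<longleftrightarrow> {?f x, ?f v} \<in> add_vertex y (f ` K) E'"
    if "v \<in> insert x V" for v
  proof (cases "v = x")
    case True
    then show ?thesis
      using xK nE(1)[of x] nE(2)[of y] add_vertex_new[of x x E K] add_vertex_new[of y y E' "f ` K"] by simp
  next
    case False
    then show ?thesis
      using that fK[of v] by (simp add: add_vertex_new nE del: image_iff)
  qed
  have "{u, v} \<in> add_vertex x K E \<longleftrightarrow> {?f u, ?f v} \<in> add_vertex y (f ` K) E'"
    if "u \<in> insert x V" "v \<in> insert x V" for u v
  proof -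
    consider "u = x" | "v = x" | "u \<noteq> x" "v \<noteq> x"
      by blast
    then show ?thesis
    proof cases
      case 1
      then show ?thesis
        using one[of v] that by blast
    next
      case 2
      then show ?thesis
        using one[of u] that by (simp only: insert_commute[of u] insert_commute[of "?f u"])
    next
      case 3
      then show ?thesis
        using that adj fy by (simp add: add_vertex_old)
    qed
  qed
  moreover have "bij_betw ?f (insert x V) (insert y V')"
    using bij x by (auto simp: bij_betw_def inj_on_def)
  ultimately show ?thesis
    by (simp add: isomorphism_def)
qed

text \<open>The neighbourhood of \<open>x\<close> is exactly \<open>K - {x}\<close>: the clique
  supplies these neighbours, and stability of \<open>insert x S\<close> excludes all others.
  Deleting \<open>x\<close> thus loses nothing once \<open>K - {x}\<close> is remembered.\<close>

lemma add_vertex_delete: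
  assumes E: "simple_graph (insert x V) E" and KS: "split_partition (insert x V) E K S"
    and x: "x \<in> K" "x \<notin> V" and st: "stable_set (insert x V) E (insert x S)"
  shows "\<exists>H. simple_graph V H \<and> split_partition V H (K - {x}) S \<and> E = add_vertex x (K - {x}) H"
proof (intro exI conjI)
  let ?H = "{e \<in> E. x \<notin> e}"
  have V: "K \<union> S = insert x V" "K \<inter> S = {}" "clique (insert x V) E K" "stable_set (insert x V) E S"
    using KS by (auto simp: split_partition_def)
  show "simple_graph V ?H"
    using E by (auto simp: simple_graph_def)
  show "split_partition V ?H (K - {x}) S"
    using V x unfolding split_partition_def clique_def stable_set_def by auto
  have "e \<in> (\<lambda>u. {x, u}) ` (K - {x})" if e: "e \<in> E" "x \<in> e" for e
  proof -
    have "card e = 2" "e \<subseteq> insert x V"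
      using E e by (auto simp: simple_graph_def)
    then obtain u where u: "e = {x, u}" "u \<noteq> x"
      using e(2) by (auto simp: card_2_iff insert_commute)
    then have "u \<notin> S"
      using e st unfolding stable_set_def by blast
    then show ?thesis
      using u V \<open>e \<subseteq> insert x V\<close> by blast
  qed
  moreover have "(\<lambda>u. {x, u}) ` (K - {x}) \<subseteq> E"
    using V(3) x unfolding clique_def by (intro image_subsetI) (metis DiffE singletonI)
  ultimately show "E = add_vertex x (K - {x}) ?H"
    unfolding add_vertex_def by blast
qed

section \<open>Swing vertices of unbalanced split graphs\<close>

lemma finite_card_image_subsets:
  assumes "finite V" "\<And>K. P K \<Longrightarrow> K \<subseteq> V"
  shows "finite {card K | K. P K}"
proof -
  have "{card K | K. P K} \<subseteq> card ` Pow V"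
    using assms(2) by auto
  then show ?thesis
    using assms(1) finite_subset by blast
qed

lemma larger_clique_exists:
  assumes "finite V" "clique V E K" "card K \<noteq> clique_number V E"
  shows "\<exists>Q. clique V E Q \<and> card K < card Q"
proof -
  let ?A = "{card Q | Q. clique V E Q}"
  have fin: "finite ?A"
    using assms(1) by (rule finite_card_image_subsets) (simp add: clique_def)
  have K: "card K \<in> ?A"
    using assms(2) by auto
  then have "Max ?A \<in> ?A"
    using fin by (intro Max_in) auto
  moreover have "card K < Max ?A"
    using Max_ge[OF fin K] assms(3) by (simp add: clique_number_def)
  ultimately show ?thesis
    by force
qed

lemma larger_stable_set_exists:
  assumes "finite V" "stable_set V E S" "card S \<noteq> independence_number V E"
  shows "\<exists>T. stable_set V E T \<and> card S < card T"
proof -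
  let ?A = "{card T | T. stable_set V E T}"
  have fin: "finite ?A"
    using assms(1) by (rule finite_card_image_subsets) (simp add: stable_set_def)
  have S: "card S \<in> ?A"
    using assms(2) by auto
  then have "Max ?A \<in> ?A"
    using fin by (intro Max_in) auto
  moreover have "card S < Max ?A"
    using Max_ge[OF fin S] assms(3) by (simp add: independence_number_def)
  ultimately show ?thesis
    by force
qed

text \<open>\<open>Q\<close> has at most \<open>card A\<close> elements in \<open>A\<close> and at
  most one in \<open>B\<close>, so exceeding \<open>card A\<close> forces it to contain all of
  \<open>A\<close> and one element of \<open>B\<close>. This serves large cliques with
  \<open>A = K\<close>, \<open>B = S\<close> and large stable sets with the roles exchanged.\<close>

lemma larger_set_is_insert:
  assumes fin: "finite (A \<union> B)" and Q: "Q \<subseteq> A \<union> B" and small: "card (Q \<inter> B) \<le> 1"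
    and large: "card A < card Q" and disj: "A \<inter> B = {}"
  shows "\<exists>b\<in>B. insert b A \<subseteq> Q"
proof -
  have "Q = (Q \<inter> A) \<union> (Q \<inter> B)"
    using Q by blast
  then have "card Q \<le> card (Q \<inter> A) + card (Q \<inter> B)"
    using card_Un_le by metis
  moreover have "card (Q \<inter> A) \<le> card A"
    using fin by (intro card_mono) auto
  ultimately have "card (Q \<inter> A) = card A" "card (Q \<inter> B) \<noteq> 0"
    using small large by linarith+
  then have "Q \<inter> A = A" "Q \<inter> B \<noteq> {}"
    using fin card_subset_eq[of A "Q \<inter> A"] by auto
  then show ?thesis
    by blast
qed

text \<open>Without balance, one part of any split partition is below maximum size, and then a
  single vertex can change sides. The partition is chosen so that this vertex lies in the
  clique.\<close>

lemma unbalanced_swing_vertex: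
  assumes E: "split_graph V E" and unbal: "\<not> balanced_split_graph V E"
  shows "\<exists>K S v. split_partition V E K S \<and> v \<in> K \<and> stable_set V E (insert v S)"
proof -
  obtain K S where sg: "simple_graph V E" and KS: "split_partition V E K S"
    using E by (auto simp: split_graph_def)
  have fin: "finite V"
    using sg by (simp add: simple_graph_def)
  have V: "K \<union> S = V" "K \<inter> S = {}" "clique V E K" "stable_set V E S"
    using KS by (auto simp: split_partition_def)
  consider "card K \<noteq> clique_number V E" | "card S \<noteq> independence_number V E"
    using unbal sg KS by (auto simp: balanced_split_graph_def)
  then show ?thesis
  proof cases
    case 1
    then obtain Q where Q: "clique V E Q" "card K < card Q"
      using larger_clique_exists fin V(3) by blast
    have "\<exists>s\<in>S. insert s K \<subseteq> Q"
      using Q V fin card_clique_Int_stable_le[OF Q(1) V(4) fin]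
      by (intro larger_set_is_insert) (auto simp: clique_def)
    then obtain s where s: "s \<in> S" "insert s K \<subseteq> Q"
      by blast
    have "clique V E (insert s K)"
      using Q(1) s(2) unfolding clique_def by blast
    moreover have "stable_set V E (S - {s})"
      using V(4) unfolding stable_set_def by blast
    ultimately have "split_partition V E (insert s K) (S - {s})"
      using s V unfolding split_partition_def by blast
    \<comment> \<open>Once moved into the clique, \<open>s\<close> is the swing vertex: returning it
      to \<open>S - {s}\<close> gives the stable set \<open>S\<close>.\<close>
    then show ?thesis
      using V(4) s(1) by (metis insertI1 insert_Diff)
  next
    case 2
    then obtain T where T: "stable_set V E T" "card S < card T"
      using larger_stable_set_exists fin V(4) by blast
    have "\<exists>v\<in>K. insert v S \<subseteq> T"
      using T V fin card_clique_Int_stable_le[OF V(3) T(1) fin]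
      by (intro larger_set_is_insert) (auto simp: stable_set_def Int_commute Un_commute)
    then obtain v where v: "v \<in> K" "insert v S \<subseteq> T"
      by blast
    then have "stable_set V E (insert v S)"
      using T(1) unfolding stable_set_def by blast
    then show ?thesis
      using KS v(1) by blast
  qed
qed

section \<open>Unbalanced graphs as one-vertex extensions\<close>

lemma unbalanced_eq_add_vertex:
  assumes E: "split_graph {..<Suc m} E" and unbal: "\<not> balanced_split_graph {..<Suc m} E"
  shows "\<exists>H K S. simple_graph {..<m} H \<and> split_partition {..<m} H K S \<and>
           (E, add_vertex m K H) \<in> iso_rel (Suc m)"
proof -
  obtain K S v where KS: "split_partition {..<Suc m} E K S" and v: "v \<in> K"
    and st: "stable_set {..<Suc m} E (insert v S)"
    using unbalanced_swing_vertex[OF E unbal] by blast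
  have sg: "simple_graph {..<Suc m} E"
    using E by (simp add: split_graph_def)
  \<comment> \<open>Relabelling sends the swing vertex to \<open>m\<close>, so that deleting it
    leaves the standard vertex set \<open>{..<m}\<close>.\<close>
  let ?t = "transpose v m" and ?V = "insert m {..<m}"
  have V: "?V = {..<Suc m}"
    by auto
  have "v \<in> {..<Suc m}"
    using v KS by (auto simp: split_partition_def)
  then have bij: "bij_betw ?t {..<Suc m} {..<Suc m}"
    by (intro bij_betw_byWitness[where f' = ?t]) (auto simp: transpose_def)
  define E' where "E' = (`) ?t ` E"
  have iso: "isomorphism ?t {..<Suc m} E {..<Suc m} E'" and sg': "simple_graph {..<Suc m} E'"
    using isomorphism_image_edges[OF bij sg] by (simp_all add: E'_def)
  have "m \<in> ?t ` K"
    using v by (metis image_eqI transpose_apply_first)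
  moreover have "stable_set {..<Suc m} E' (insert m (?t ` S))"
    using stable_set_image[OF iso st] by simp
  ultimately obtain H where H: "simple_graph {..<m} H" "split_partition {..<m} H (?t ` K - {m}) (?t ` S)"
    "E' = add_vertex m (?t ` K - {m}) H"
    using add_vertex_delete[of m "{..<m}" E' "?t ` K" "?t ` S"] sg' split_partition_image[OF iso KS]
    unfolding V by blast
  have "(E, E') \<in> iso_rel (Suc m)"
    using iso sg sg' by (auto simp: iso_rel_def graph_iso_iff)
  then show ?thesis
    using H by blast
qed

text \<open>The isomorphism carries \<open>K\<close> to a split clique of \<open>H'\<close>, whose
  size differs from \<open>card K'\<close> by at most one. Equal parity therefore gives equal size,
  and \<open>split_partition_automorphism\<close> corrects the isomorphism so that it maps
  \<open>K\<close> onto \<open>K'\<close>.\<close>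

lemma add_vertex_iso:
  assumes iso: "(H, H') \<in> iso_rel m" and KS: "split_partition {..<m} H K S"
    and KS': "split_partition {..<m} H' K' S'" and par: "even (card K) = even (card K')"
  shows "graph_iso {..<Suc m} (add_vertex m K H) {..<Suc m} (add_vertex m K' H')"
proof -
  obtain f where f: "isomorphism f {..<m} H {..<m} H'"
    and sg: "simple_graph {..<m} H" "simple_graph {..<m} H'"
    using iso by (auto simp: iso_rel_def graph_iso_iff)
  have sub: "K \<subseteq> {..<m}"
    using KS by (auto simp: split_partition_def)
  have fKS: "split_partition {..<m} H' (f ` K) (f ` S)"
    using split_partition_image[OF f KS] .
  have "card (f ` K) = card K"
    using f sub by (intro card_image) (auto simp: isomorphism_def bij_betw_def inj_on_subset)
  moreover have "card (f ` K) \<le> card K' + 1" "card K' \<le> card (f ` K) + 1"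
    using card_split_clique_le fKS KS' by blast+
  ultimately have "card (f ` K) = card K'"
    using par by presburger
  then obtain g where g: "isomorphism g {..<m} H' {..<m} H'" "g ` f ` K = K'"
    using split_partition_automorphism[OF fKS KS'] by auto
  have "isomorphism (g \<circ> f) {..<m} H {..<m} H'" "(g \<circ> f) ` K = K'"
    using isomorphism_comp[OF f g(1)] g(2) by (auto simp: image_comp)
  then have "isomorphism ((g \<circ> f)(m := m)) (insert m {..<m}) (add_vertex m K H)
               (insert m {..<m}) (add_vertex m K' H')"
    using isomorphism_add_vertex[of "g \<circ> f" "{..<m}" H "{..<m}" H' K m m] sg sub by simp
  then show ?thesis
    unfolding graph_iso_iff lessThan_Suc by blast
qed

section \<open>Counting isomorphism classes and the limit\<close>

lemma unlabeled_split_graphs_nonempty: "unlabeled_split_graphs n \<noteq> {}"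
proof -
  \<comment> \<open>The edgeless graph is the witness; nonemptiness keeps the denominators of the
    ratios positive.\<close>
  have "split_partition {..<n} {} {} {..<n}"
    by (simp add: split_partition_def clique_def stable_set_def)
  then have "split_graph {..<n} {}"
    unfolding split_graph_def simple_graph_def by auto
  then show ?thesis
    by (auto simp: unlabeled_split_graphs_def quotient_def)
qed

lemma finite_unlabeled_split_graphs: "finite (unlabeled_split_graphs n)"
proof -
  have "{E. split_graph {..<n} E} \<subseteq> Pow (Pow {..<n})"
    by (auto simp: split_graph_def simple_graph_def)
  then have "finite {E. split_graph {..<n} E}"
    by (rule finite_subset) simp
  then show ?thesis
    by (simp add: unlabeled_split_graphs_def quotient_def)
qed

lemma unlabeled_balanced_subset: "unlabeled_balanced_split_graphs n \<subseteq> unlabeled_split_graphs n"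
  unfolding unlabeled_balanced_split_graphs_def unlabeled_split_graphs_def quotient_def
    balanced_split_graph_def split_graph_def by blast

text \<open>Each unbalanced class is encoded by the class of a graph with one vertex fewer and a
  parity bit, which accounts for the factor 2. The code is injective by
  \<open>add_vertex_iso\<close>.\<close>

lemma card_unbalanced_le:
  "card (unlabeled_split_graphs (Suc m) - unlabeled_balanced_split_graphs (Suc m))
     \<le> 2 * card (unlabeled_split_graphs m)" (is "card ?U \<le> _")
proof -
  \<comment> \<open>The pair \<open>p\<close> is \<open>(H, K)\<close>: the smaller graph and the
    clique to which vertex \<open>m\<close> is joined.\<close>
  have "\<exists>p. simple_graph {..<m} (fst p) \<and> (\<exists>S. split_partition {..<m} (fst p) (snd p) S) \<and>
          X = iso_rel (Suc m) `` {add_vertex m (snd p) (fst p)} \<and>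
          add_vertex m (snd p) (fst p) \<in> X" if X: "X \<in> ?U" for X
  proof -
    obtain E where E: "X = iso_rel (Suc m) `` {E}" "split_graph {..<Suc m} E"
      using X by (auto simp: unlabeled_split_graphs_def quotient_def)
    have "\<not> balanced_split_graph {..<Suc m} E"
      using X E(1) by (auto simp: unlabeled_balanced_split_graphs_def quotient_def)
    then obtain H K S where H: "simple_graph {..<m} H" "split_partition {..<m} H K S"
      "(E, add_vertex m K H) \<in> iso_rel (Suc m)"
      using unbalanced_eq_add_vertex E(2) by blast
    then have "X = iso_rel (Suc m) `` {add_vertex m K H}"
      using E(1) equiv_class_eq[OF equiv_iso_rel] by blast
    then show ?thesis
      using H E(1) by (intro exI[of _ "(H, K)"]) auto
  qed
  then obtain p where p: "\<And>X. X \<in> ?U \<Longrightarrow> simple_graph {..<m} (fst (p X)) \<and>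
      (\<exists>S. split_partition {..<m} (fst (p X)) (snd (p X)) S) \<and>
      X = iso_rel (Suc m) `` {add_vertex m (snd (p X)) (fst (p X))} \<and>
      add_vertex m (snd (p X)) (fst (p X)) \<in> X"
    by metis
  let ?c = "\<lambda>X. (iso_rel m `` {fst (p X)}, even (card (snd (p X))))"
  have "inj_on ?c ?U"
  proof (rule inj_onI)
    fix X Y assume X: "X \<in> ?U" and Y: "Y \<in> ?U" and eq: "?c X = ?c Y"
    have "(fst (p X), fst (p Y)) \<in> iso_rel m"
      using eq p[OF X] p[OF Y] eq_equiv_class_iff[OF equiv_iso_rel] by simp
    then have "graph_iso {..<Suc m} (add_vertex m (snd (p X)) (fst (p X)))
                 {..<Suc m} (add_vertex m (snd (p Y)) (fst (p Y)))"
      using add_vertex_iso p[OF X] p[OF Y] eq by blast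
    \<comment> \<open>The extension belongs to its own class, hence is related to itself, and
      \<open>iso_rel\<close> relates only simple graphs.\<close>
    moreover have "simple_graph {..<Suc m} (add_vertex m (snd (p Z)) (fst (p Z)))" if "Z \<in> ?U" for Z
      using p[OF that] by (auto simp: iso_rel_def)
    ultimately have "(add_vertex m (snd (p X)) (fst (p X)), add_vertex m (snd (p Y)) (fst (p Y)))
                       \<in> iso_rel (Suc m)"
      using X Y by (simp add: iso_rel_def)
    then show "X = Y"
      using p[OF X] p[OF Y] equiv_class_eq[OF equiv_iso_rel] by metis
  qed
  moreover have "?c ` ?U \<subseteq> unlabeled_split_graphs m \<times> UNIV"
  proof (rule image_subsetI)
    fix X assume "X \<in> ?U"
    then have "split_graph {..<m} (fst (p X))"
      using p unfolding split_graph_def by blast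
    then show "?c X \<in> unlabeled_split_graphs m \<times> UNIV"
      by (simp add: unlabeled_split_graphs_def quotientI)
  qed
  ultimately have "card ?U \<le> card (unlabeled_split_graphs m \<times> (UNIV :: bool set))"
    using finite_unlabeled_split_graphs by (intro card_inj_on_le) auto
  then show ?thesis
    by (simp add: card_cartesian_product)
qed

theorem theorem5p2:
  assumes "(\<lambda>n. real (card (unlabeled_split_graphs (n - 1))) / real (card (unlabeled_split_graphs n)))
             \<longlonglongrightarrow> 0"
  shows "(\<lambda>n. real (card (unlabeled_balanced_split_graphs n)) / real (card (unlabeled_split_graphs n)))
           \<longlonglongrightarrow> 1"
proof (rule tendsto_sandwich)
  let ?s = "\<lambda>n. real (card (unlabeled_split_graphs n))"
  let ?b = "\<lambda>n. real (card (unlabeled_balanced_split_graphs n))"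
  have pos: "?s n > 0" for n
    using unlabeled_split_graphs_nonempty finite_unlabeled_split_graphs by (simp add: card_gt_0_iff)
  have le: "card (unlabeled_balanced_split_graphs n) \<le> card (unlabeled_split_graphs n)" for n
    by (intro card_mono finite_unlabeled_split_graphs unlabeled_balanced_subset)
  \<comment> \<open>This is \<open>card_unbalanced_le\<close> divided by \<open>?s n\<close>. It
    starts at \<open>n = 1\<close> because only there is \<open>n - 1\<close> a true
    predecessor.\<close>
  show "\<forall>\<^sub>F n in sequentially. 1 - 2 * (?s (n - 1) / ?s n) \<le> ?b n / ?s n"
  proof (rule eventually_sequentiallyI[of 1])
    fix n :: nat assume "1 \<le> n"
    then obtain m where n: "n = Suc m"
      using not0_implies_Suc by force
    have "card (unlabeled_split_graphs n - unlabeled_balanced_split_graphs n)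
            = card (unlabeled_split_graphs n) - card (unlabeled_balanced_split_graphs n)"
      using finite_unlabeled_split_graphs unlabeled_balanced_subset
      by (intro card_Diff_subset) (auto intro: finite_subset)
    then have "?s n - 2 * ?s (n - 1) \<le> ?b n"
      using card_unbalanced_le[of m] le[of n] unfolding n by simp
    then have "(?s n - 2 * ?s (n - 1)) / ?s n \<le> ?b n / ?s n"
      using pos[of n] by (intro divide_right_mono) simp_all
    then show "1 - 2 * (?s (n - 1) / ?s n) \<le> ?b n / ?s n"
      using pos[of n] by (simp add: diff_divide_distrib)
  qed
  show "\<forall>\<^sub>F n in sequentially. ?b n / ?s n \<le> 1"
    using le pos by (intro always_eventually) (simp add: divide_le_eq_1)
  show "(\<lambda>n. 1 - 2 * (?s (n - 1) / ?s n)) \<longlonglongrightarrow> 1"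
    using tendsto_diff[OF tendsto_const tendsto_mult_left[OF assms, of 2], of 1] by simp
qed simp

end
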